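(* For nonnegative integers $m,n,r$ and any number $\alpha\neq 0$, \begin{align*} &\sum_{a=0}^{m-r-2}\sum_{b=0}^{n-r-2}\binom{(1+\alpha)m-a+b-1}{m-r-2-a}\binom{(1+\alpha^{-1})n+a-b-1}{n-r-2-b}\\ &\quad+\sum_{a=0}^{m+r}\sum_{b=0}^{n+r}\binom{(1+\alpha)m-a+b-1}{m+r-a}\binom{(1+\alpha^{-1})n+a-b-1}{n+r-b}\\ &=\frac{2mn}{(1+\alpha)(m+\alpha^{-1}n)}\binom{(1+\alpha)m}{m}\binom{(1+\alpha^{-1})n}{n} +\sum_{k=-r}^{r}(r-|k|+1)\binom{(1+\alpha)m}{m-k}\binom{(1+\alpha^{-1})n}{n-k}. \end{align*}
   Context: For an arbitrary (complex) number $z$ and an integer $k$, the binomial coefficient is $\binom{z}{k}=\frac{z(z-1)\cdots(z-k+1)}{k!}$ for $k\ge 0$ and $\binom{z}{k}=0$ for $k<0$. A sum whose upper limit is smaller than its lower limit is empty and equals $0$.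
   Formalization: Where the denominator (1+α)(m+n/α) vanishes (α = -1, α = -n/m, or m = n = 0) the fraction term is undefined as written; there it is read as its limit in α (equal to 0 when m = n = 0), and the identity is proved in those cases too. *)

theory Defs
  imports "HOL-Analysis.Analysis"
begin

definition binom :: "complex \<Rightarrow> int \<Rightarrow> complex" where
  "binom z k = (if k < 0 then 0 else z gchoose (nat k))"

definition denom :: "nat \<Rightarrow> nat \<Rightarrow> complex \<Rightarrow> complex" where
  "denom m n \<alpha> = (1 + \<alpha>) * (of_nat m + inverse \<alpha> * of_nat n)"

definition frac_term :: "nat \<Rightarrow> nat \<Rightarrow> complex \<Rightarrow> complex" where
  "frac_term m n \<alpha> =
     2 * of_nat m * of_nat n / denom m n \<alpha>
       * binom ((1 + \<alpha>) * of_nat m) (int m)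
       * binom ((1 + inverse \<alpha>) * of_nat n) (int n)"

text \<open>
  The denominator vanishes for \<open>\<alpha> = -1\<close>, for \<open>\<alpha> = -n/m\<close>, and for \<open>m = n = 0\<close>.
  For \<open>(m, n) \<noteq> (0, 0)\<close> and \<open>\<alpha> \<noteq> 0\<close> the singularity in \<open>\<alpha>\<close> is removable, because the two
  binomial coefficients have the factors \<open>1 + \<alpha>\<close> and \<open>\<alpha>m + n\<close> when \<open>m, n > 0\<close>, and the
  factor \<open>mn\<close> is \<open>0\<close> otherwise. The term is then read as its limit; the
  convention \<open>x / 0 = 0\<close> would make the identity false there, e.g. for
  \<open>m = n = 1\<close>, \<open>\<alpha> = -1\<close>. For \<open>m = n = 0\<close> the term is \<open>0\<close>.
\<close>

definition frac_term_ext :: "nat \<Rightarrow> nat \<Rightarrow> complex \<Rightarrow> complex" where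
  "frac_term_ext m n \<alpha> =
     (if denom m n \<alpha> \<noteq> 0 then frac_term m n \<alpha> else Lim (at \<alpha>) (frac_term m n))"

end

theory Submission
  imports Defs
begin

text \<open>
  Write \<open>x = (1 + \<alpha>) m\<close> and \<open>y = (1 + 1/\<alpha>) n\<close>. Each double sum is a coefficient of
  \<open>(1+u)\<^sup>x (1+v)\<^sup>y / (1-uv)\<^sup>2\<close>, because
  \<open>(1 - u(1+v)/(1+u)) (1 - v(1+u)/(1+v)) = (1-uv)\<^sup>2 / ((1+u)(1+v))\<close>; this holds for all \<open>x\<close>, \<open>y\<close>.
  Both sides thereby become weighted sums of \<open>h j = binom x (m-j) binom y (n-j)\<close>, and
  comparing weights leaves the claim that \<open>2 \<Sum>\<^sub>j j h j\<close> (over \<open>j \<ge> 0\<close>) is the fraction term.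
  As \<open>(x-m)(y-n) = mn\<close>, one has \<open>(x+y) j h j = T j - T (j+1)\<close> with
  \<open>T j = (x-m+j)(y-n+j) h j\<close>, so the sum telescopes to \<open>T 0 = mn h 0\<close> while
  \<open>x + y\<close> is the denominator. At its zeros the claim follows by continuity in \<open>\<alpha>\<close>.
\<close>

section \<open>Binomial coefficients with integer lower index\<close>

lemma binom_neg: "k < 0 \<Longrightarrow> binom z k = 0"
  by (simp add: binom_def)

lemma isCont_binom:
  assumes "isCont f a"
  shows "isCont (\<lambda>z. binom (f z) k) a"
proof (cases "k < 0")
  case True
  then show ?thesis by (simp add: binom_def)
next
  case False
  then have "(\<lambda>z. binom (f z) k) = (\<lambda>z. (\<Prod>i = 0..<nat k. f z - of_nat i) / fact (nat k))"
    by (simp add: binom_def gbinomial_prod_rev)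
  then show ?thesis
    using assms by (auto intro!: continuous_intros)
qed

lemma binom_pascal: "binom (z + 1) k = binom z k + binom z (k - 1)"
proof (cases "k \<le> 0")
  case True
  then show ?thesis by (auto simp: binom_def)
next
  case False
  then obtain j where "k = int (Suc j)"
    by (metis not_less zero_less_imp_eq_int gr0_conv_Suc)
  then show ?thesis
    by (simp add: binom_def gbinomial_Suc_Suc nat_add_distrib add.commute[of _ "z gchoose j"])
qed

lemma binom_absorb:
  "of_int k * binom z k = (z - of_int k + 1) * binom z (k - 1)"
proof (cases "k \<le> 0")
  case True
  then show ?thesis by (auto simp: binom_def)
next
  case False
  then obtain j where k: "k = int (Suc j)"
    by (metis not_less zero_less_imp_eq_int gr0_conv_Suc)
  have "of_nat (Suc j) * (z gchoose Suc j) = (z - of_nat j) * (z gchoose j)"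
    using gbinomial_absorption'[of "Suc j" z] gbinomial_mult_1[of z j]
    by (simp add: algebra_simps)
  then show ?thesis
    by (simp add: k binom_def nat_add_distrib)
qed

section \<open>Reindexing and the double sums\<close>

lemma sum_int_to_nat:
  fixes f :: "int \<Rightarrow> 'a::comm_monoid_add"
  assumes "p < int N" "\<And>a. a > p \<Longrightarrow> f a = 0"
  shows "(\<Sum>a = 0..p. f a) = (\<Sum>a<N. f (int a))"
proof -
  have "(\<Sum>a = 0..p. f a) = (\<Sum>a \<in> {0..<int N}. f a)"
    using assms by (intro sum.mono_neutral_left) auto
  also have "\<dots> = (\<Sum>a<N. f (int a))"
    by (rule sum.reindex_bij_witness[of _ int nat]) auto
  finally show ?thesis .
qed

lemma sum_nat_to_int_shift:
  fixes f :: "int \<Rightarrow> 'a::comm_monoid_add"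
  shows "(\<Sum>k<N. f (int k + c)) = (\<Sum>j = c..c + int N - 1. f j)"
  by (rule sum.reindex_bij_witness[of _ "\<lambda>j. nat (j - c)" "\<lambda>k. int k + c"]) auto

text \<open>The coefficient form of \<open>\<Sum>\<^sub>a (u(1+v)/(1+u))\<^sup>a = (1+u)/(1-uv)\<close>.\<close>

lemma binom_geometric_sum:
  assumes "p < int N"
  shows "(\<Sum>a<N. binom (x - of_nat a) (p - int a) * binom (y + of_nat a) q)
       = (\<Sum>k<N. binom (x + 1) (p - int k) * binom y (q - int k))"
  using assms
proof (induction N arbitrary: p q)
  case 0
  then show ?case by simp
next
  case (Suc N)
  \<comment> \<open>\<open>T a\<close> is the coefficient of u^p v^q in u^a (1+u)^(x+1-a)
    (1+v)^(y+a). Subtracting the sum for (p-1, q-1) multiplies the generating function by 1 - uv =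
    (1+u) - u(1+v), which makes it telescope.\<close>
  define T where "T a = binom (x + 1 - of_nat a) (p - int a) * binom (y + of_nat a) q" for a
  have step: "binom (x - of_nat a) (p - int a) * binom (y + of_nat a) q
      - binom (x - of_nat a) (p - 1 - int a) * binom (y + of_nat a) (q - 1) = T a - T (Suc a)"
    for a
    using binom_pascal[of "x - of_nat a" "p - int a"] binom_pascal[of "y + of_nat a" q]
    by (simp add: T_def algebra_simps)
  have "(\<Sum>a<Suc N. binom (x - of_nat a) (p - int a) * binom (y + of_nat a) q)
      - (\<Sum>a<Suc N. binom (x - of_nat a) (p - 1 - int a) * binom (y + of_nat a) (q - 1))
      = T 0 - T (Suc N)"
    unfolding sum_subtractf[symmetric] step by (rule sum_lessThan_telescope')
  moreover have "T 0 = binom (x + 1) p * binom y q"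
    by (simp add: T_def)
  moreover have "T (Suc N) = 0"
    using Suc.prems by (simp add: T_def binom_neg)
  \<comment> \<open>The induction hypothesis covers the summands a < N; the one at a = N vanishes
    since p - 1 - N < 0.\<close>
  moreover have "(\<Sum>a<Suc N. binom (x - of_nat a) (p - 1 - int a) * binom (y + of_nat a) (q - 1))
      = (\<Sum>k<N. binom (x + 1) (p - 1 - int k) * binom y (q - 1 - int k))"
    using Suc.IH[of "p - 1" "q - 1"] Suc.prems by (simp add: binom_neg)
  ultimately show ?case
    unfolding sum.lessThan_Suc_shift[of "\<lambda>k. binom (x + 1) (p - int k) * binom y (q - int k)"]
    by (simp add: diff_diff_eq diff_eq_eq del: sum.lessThan_Suc)
qed

text \<open>The coefficient form of 1/(1-w)^2: exactly j + 1 pairs satisfy k + l = j, and the pairs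
  of the square with k + l >= N contribute 0.\<close>

lemma sum_square_antidiagonals:
  fixes g :: "nat \<Rightarrow> 'a::comm_semiring_1"
  assumes "\<And>j. j \<ge> N \<Longrightarrow> g j = 0"
  shows "(\<Sum>k<N. \<Sum>l<N. g (k + l)) = (\<Sum>j<N. of_nat (Suc j) * g j)"
proof -
  have "(\<Sum>k<N. \<Sum>l<N. g (k + l)) = (\<Sum>(k,l)\<in>{..<N} \<times> {..<N}. g (k + l))"
    by (simp add: sum.cartesian_product)
  also have "\<dots> = (\<Sum>(k,l)\<in>{(i,j). i + j < N}. g (k + l))"
    using assms by (intro sum.mono_neutral_right) (auto simp: not_less, meson not_less)
  also have "\<dots> = (\<Sum>j<N. \<Sum>i\<le>j. g (i + (j - i)))"
    by (rule sum.triangle_reindex)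
  also have "\<dots> = (\<Sum>j<N. of_nat (Suc j) * g j)"
    by (intro sum.cong refl) simp
  finally show ?thesis .
qed

lemma binom_double_sum_nat:
  assumes "p < int N" "q < int N"
  shows "(\<Sum>a<N. \<Sum>b<N. binom (x - of_nat a + of_nat b - 1) (p - int a)
            * binom (y + of_nat a - of_nat b - 1) (q - int b))
       = (\<Sum>k<N. of_nat (Suc k) * (binom x (p - int k) * binom y (q - int k)))"
proof -
  have "(\<Sum>a<N. \<Sum>b<N. binom (x - of_nat a + of_nat b - 1) (p - int a)
            * binom (y + of_nat a - of_nat b - 1) (q - int b))
      = (\<Sum>b<N. \<Sum>a<N. binom (x + of_nat b - 1 - of_nat a) (p - int a)
            * binom (y - of_nat b - 1 + of_nat a) (q - int b))"
    by (subst sum.swap) (simp add: algebra_simps)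
  \<comment> \<open>First factor 1/(1-uv): the sum over a for fixed b.\<close>
  also have "\<dots> = (\<Sum>b<N. \<Sum>k<N. binom (x + of_nat b) (p - int k)
            * binom (y - of_nat b - 1) (q - int b - int k))"
    by (simp add: binom_geometric_sum[OF assms(1)])
  also have "\<dots> = (\<Sum>k<N. \<Sum>b<N. binom (y - 1 - of_nat b) (q - int k - int b)
            * binom (x + of_nat b) (p - int k))"
    by (subst sum.swap) (simp add: algebra_simps)
  \<comment> \<open>Second factor 1/(1-uv): the sum over b for fixed k, with the roles of x and y
    exchanged.\<close>
  also have "\<dots> = (\<Sum>k<N. \<Sum>l<N. binom x (p - int (k + l)) * binom y (q - int (k + l)))"
  proof (rule sum.cong[OF refl])
    fix k
    have "q - int k < int N" using assms by simp
    from binom_geometric_sum[OF this, of "y - 1" x "p - int k"]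
    show "(\<Sum>b<N. binom (y - 1 - of_nat b) (q - int k - int b) * binom (x + of_nat b) (p - int k))
        = (\<Sum>l<N. binom x (p - int (k + l)) * binom y (q - int (k + l)))"
      by (simp add: algebra_simps)
  qed
  also have "\<dots> = (\<Sum>k<N. of_nat (Suc k) * (binom x (p - int k) * binom y (q - int k)))"
    using assms by (intro sum_square_antidiagonals) (auto simp: binom_neg)
  finally show ?thesis .
qed

text \<open>The limits p and q may be negative. The integer sum is then empty, and over the naturals
  every summand has a negative lower index and vanishes, so a single bound N serves all
  cases.\<close>

lemma binom_double_sum:
  assumes "p < int N" "q < int N"
  shows "(\<Sum>a::int = 0..p. \<Sum>b::int = 0..q. binom (x - of_int a + of_int b - 1) (p - a)
            * binom (y + of_int a - of_int b - 1) (q - b))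
       = (\<Sum>k<N. of_nat (Suc k) * (binom x (p - int k) * binom y (q - int k)))"
proof -
  have "(\<Sum>b = 0..q. binom (x - of_int a + of_int b - 1) (p - a)
            * binom (y + of_int a - of_int b - 1) (q - b))
      = (\<Sum>b<N. binom (x - of_int a + of_nat b - 1) (p - a)
            * binom (y + of_int a - of_nat b - 1) (q - int b))" for a :: int
    using assms by (subst sum_int_to_nat[of _ N]) (auto simp: binom_neg)
  then have "(\<Sum>a::int = 0..p. \<Sum>b::int = 0..q. binom (x - of_int a + of_int b - 1) (p - a)
            * binom (y + of_int a - of_int b - 1) (q - b))
      = (\<Sum>a<N. \<Sum>b<N. binom (x - of_nat a + of_nat b - 1) (p - int a)
            * binom (y + of_nat a - of_nat b - 1) (q - int b))"
    using assms by simp (subst sum_int_to_nat[of _ N], auto simp: binom_neg)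
  with binom_double_sum_nat[OF assms] show ?thesis by simp
qed

section \<open>The fraction term as a weighted sum\<close>

lemma weighted_binom_sum_telescope:
  assumes "(x - of_nat m) * (y - of_nat n) = of_nat m * of_nat n" and "m < N"
  shows "(x + y) * (\<Sum>j<N. of_nat j * (binom x (int m - int j) * binom y (int n - int j)))
       = of_nat m * of_nat n * (binom x (int m) * binom y (int n))"
proof -
  define h where "h j = binom x (int m - int j) * binom y (int n - int j)" for j
  define T where "T j = (x - of_nat m + of_nat j) * (y - of_nat n + of_nat j) * h j" for j
  have step: "(x + y) * (of_nat j * h j) = T j - T (Suc j)" for j
  proof -
    have "of_int (int m - int j) * binom x (int m - int j)
        = (x - of_nat m + of_nat (Suc j)) * binom x (int m - int (Suc j))"
      using binom_absorb[of "int m - int j" x] by (simp add: algebra_simps)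
    moreover have "of_int (int n - int j) * binom y (int n - int j)
        = (y - of_nat n + of_nat (Suc j)) * binom y (int n - int (Suc j))"
      using binom_absorb[of "int n - int j" y] by (simp add: algebra_simps)
    \<comment> \<open>Absorption in both factors moves \<open>T (Suc j)\<close> back to index j, so
      that both T-values become multiples of \<open>h j\<close>.\<close>
    ultimately have "T (Suc j) = (of_int (int m - int j) * binom x (int m - int j))
        * (of_int (int n - int j) * binom y (int n - int j))"
      by (simp add: T_def h_def mult_ac)
    then have "T (Suc j) = (of_nat m - of_nat j) * (of_nat n - of_nat j) * h j"
      by (simp add: h_def mult_ac)
    then have "T j - T (Suc j) = ((x - of_nat m + of_nat j) * (y - of_nat n + of_nat j)
        - (of_nat m - of_nat j) * (of_nat n - of_nat j)) * h j"
      by (simp only: T_def[of j] left_diff_distrib)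
    \<comment> \<open>The hypothesis cancels the constant terms and j^2 drops out; j ((x-m) + (y-n)
      + m + n) remains.\<close>
    also have "(x - of_nat m + of_nat j) * (y - of_nat n + of_nat j)
        - (of_nat m - of_nat j) * (of_nat n - of_nat j) = (x + y) * of_nat j"
      using assms(1) by (simp add: algebra_simps)
    finally show ?thesis by (simp add: mult_ac)
  qed
  have "(x + y) * (\<Sum>j<N. of_nat j * h j) = T 0 - T N"
    unfolding sum_distrib_left step by (rule sum_lessThan_telescope')
  moreover have "T N = 0"
    using assms(2) by (simp add: T_def h_def binom_neg)
  ultimately show ?thesis
    using assms(1) by (simp add: T_def h_def)
qed

lemma frac_term_eq_sum:
  assumes "\<alpha> \<noteq> 0" "denom m n \<alpha> \<noteq> 0" "m < N"
  shows "frac_term m n \<alpha> = 2 * (\<Sum>j<N. of_nat j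
           * (binom ((1 + \<alpha>) * of_nat m) (int m - int j)
              * binom ((1 + inverse \<alpha>) * of_nat n) (int n - int j)))"
proof -
  define x y where "x = (1 + \<alpha>) * of_nat m" and "y = (1 + inverse \<alpha>) * of_nat n"
  have d: "denom m n \<alpha> = x + y"
    using assms(1) by (simp add: denom_def x_def y_def field_simps)
  \<comment> \<open>Here x - m = \<alpha> m and y - n = n/\<alpha>.\<close>
  have "(x - of_nat m) * (y - of_nat n) = of_nat m * of_nat n"
    using assms(1) by (simp add: x_def y_def field_simps)
  from weighted_binom_sum_telescope[OF this assms(3)] assms(2)
  have "(\<Sum>j<N. of_nat j * (binom x (int m - int j) * binom y (int n - int j)))
      = of_nat m * of_nat n * (binom x (int m) * binom y (int n)) / denom m n \<alpha>"
    by (simp add: d nonzero_eq_divide_eq mult.commute)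
  then show ?thesis
    by (simp add: frac_term_def x_def y_def)
qed

lemma frac_term_ext_eq_sum:
  assumes "\<alpha> \<noteq> 0" "m < N"
  shows "frac_term_ext m n \<alpha> = 2 * (\<Sum>j<N. of_nat j
           * (binom ((1 + \<alpha>) * of_nat m) (int m - int j)
              * binom ((1 + inverse \<alpha>) * of_nat n) (int n - int j)))"
    (is "_ = ?W \<alpha>")
proof (cases "denom m n \<alpha> = 0")
  case False
  then show ?thesis
    using frac_term_eq_sum assms by (simp add: frac_term_ext_def)
next
  case True
  have frac: "\<forall>\<^sub>F z in at \<alpha>. frac_term m n z = ?W z"
  proof (cases "m = 0 \<or> n = 0")
    \<comment> \<open>Both sides vanish identically: the summand j = 0 has weight 0, and for j > 0
      one lower index is negative. This includes m = n = 0, where the denominator is 0 for every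
      z.\<close>
    case True
    then have "of_nat j * (binom x (int m - int j) * binom y (int n - int j)) = 0" for x y j
      by (cases j) (auto simp: binom_neg)
    then have "?W z = 0" for z
      by (simp only: sum.neutral_const mult_zero_right)
    with True show ?thesis by (auto simp: frac_term_def)
  next
    case False
    \<comment> \<open>For m, n > 0 the denominator has only the zeros -1 and -n/m among z \<noteq>
      0, so a punctured neighbourhood avoids them.\<close>
    have "\<forall>\<^sub>F z in at \<alpha>. z \<noteq> 0" "\<forall>\<^sub>F z in at \<alpha>. z \<noteq> - 1"
      "\<forall>\<^sub>F z in at \<alpha>. z \<noteq> - of_nat n / of_nat m"
      by (rule eventually_neq_at_within)+
    then show ?thesis
    proof eventually_elim
      case (elim z)
      have "z * of_nat m + of_nat n \<noteq> 0"
        using elim(3) False by (simp add: field_simps eq_neg_iff_add_eq_0)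
      moreover have "z * (of_nat m + inverse z * of_nat n) = z * of_nat m + of_nat n"
        using elim(1) by (simp add: distrib_left flip: mult.assoc)
      moreover have "1 + z \<noteq> 0"
        using elim(2) by (simp add: add_eq_0_iff)
      ultimately have "denom m n z \<noteq> 0" by (auto simp: denom_def)
      with elim(1) assms(2) show ?case by (intro frac_term_eq_sum)
    qed
  qed
  have "isCont ?W \<alpha>"
    using assms(1) by (intro continuous_intros isCont_binom)
  then have "(?W \<longlongrightarrow> ?W \<alpha>) (at \<alpha>)"
    by (simp add: isCont_def)
  then have "(frac_term m n \<longlongrightarrow> ?W \<alpha>) (at \<alpha>)"
    using frac by (simp add: tendsto_cong)
  then have "Lim (at \<alpha>) (frac_term m n) = ?W \<alpha>"
    by (intro tendsto_Lim) auto
  with True show ?thesis by (simp add: frac_term_ext_def)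
qed

section \<open>Comparison of the weights\<close>

theorem theorem2:
  fixes m n r :: nat and \<alpha> :: complex
  assumes "\<alpha> \<noteq> 0"
  shows "(\<Sum>a::int = 0..int m - int r - 2. \<Sum>b::int = 0..int n - int r - 2.
            binom ((1 + \<alpha>) * of_nat m - of_int a + of_int b - 1) (int m - int r - 2 - a)
          * binom ((1 + inverse \<alpha>) * of_nat n + of_int a - of_int b - 1) (int n - int r - 2 - b))
       + (\<Sum>a::int = 0..int m + int r. \<Sum>b::int = 0..int n + int r.
            binom ((1 + \<alpha>) * of_nat m - of_int a + of_int b - 1) (int m + int r - a)
          * binom ((1 + inverse \<alpha>) * of_nat n + of_int a - of_int b - 1) (int n + int r - b))
       = frac_term_ext m n \<alpha>
       + (\<Sum>k::int = - int r..int r.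
            of_int (int r - \<bar>k\<bar> + 1)
          * binom ((1 + \<alpha>) * of_nat m) (int m - k)
          * binom ((1 + inverse \<alpha>) * of_nat n) (int n - k))"
proof -
  define x y where "x = (1 + \<alpha>) * of_nat m" and "y = (1 + inverse \<alpha>) * of_nat n"
  define h where "h j = binom x (int m - j) * binom y (int n - j)" for j
  define M where "M = m + n + r"
  \<comment> \<open>A common range containing all four index ranges; extending the weights by 0 to
    \<open>I\<close> reduces the identity to one between weights.\<close>
  define I where "I = {- int r..int (M + 2 * r + 2)}"
  have h0: "h j = 0" if "j > int m" for j
    using that by (simp add: h_def binom_neg)
  have weights: "(\<Sum>j\<in>J. of_int (w j) * h j) = (\<Sum>j\<in>I. of_int (if j \<in> J then w j else 0) * h j)"
    if "J \<subseteq> I" for J and w :: "int \<Rightarrow> int"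
  proof -
    have "(\<Sum>j\<in>J. of_int (w j) * h j) = (\<Sum>j\<in>J. of_int (if j \<in> J then w j else 0) * h j)"
      by (rule sum.cong) auto
    also have "\<dots> = (\<Sum>j\<in>I. of_int (if j \<in> J then w j else 0) * h j)"
      using that by (intro sum.mono_neutral_left) (auto simp: I_def)
    finally show ?thesis .
  qed
  have low: "(\<Sum>a::int = 0..int m - int r - 2. \<Sum>b::int = 0..int n - int r - 2.
            binom (x - of_int a + of_int b - 1) (int m - int r - 2 - a)
          * binom (y + of_int a - of_int b - 1) (int n - int r - 2 - b))
      = (\<Sum>j = int r + 2..int (M + r + 2). of_int (j - int r - 1) * h j)"
  proof -
    \<comment> \<open>The shift j = k + r + 2 turns the weight k + 1 into j - r - 1; in
      \<open>high\<close>, j = k - r turns it into j + r + 1.\<close>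
    have "(\<Sum>j = int r + 2..int (M + r + 2). of_int (j - int r - 1) * h j)
        = (\<Sum>k<Suc M. of_int (int k + (int r + 2) - int r - 1) * h (int k + (int r + 2)))"
      by (subst sum_nat_to_int_shift) (simp add: algebra_simps)
    then show ?thesis
      by (subst binom_double_sum[of _ "Suc M"])
        (auto simp: M_def h_def algebra_simps simp del: sum.lessThan_Suc intro!: sum.cong)
  qed
  have high: "(\<Sum>a::int = 0..int m + int r. \<Sum>b::int = 0..int n + int r.
            binom (x - of_int a + of_int b - 1) (int m + int r - a)
          * binom (y + of_int a - of_int b - 1) (int n + int r - b))
      = (\<Sum>j = - int r..int M - int r. of_int (j + int r + 1) * h j)"
  proof -
    have "(\<Sum>j = - int r..int M - int r. of_int (j + int r + 1) * h j)
        = (\<Sum>k<Suc M. of_int (int k + - int r + int r + 1) * h (int k + - int r))"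
      by (subst sum_nat_to_int_shift) (simp add: algebra_simps)
    then show ?thesis
      by (subst binom_double_sum[of _ "Suc M"])
        (auto simp: M_def h_def algebra_simps simp del: sum.lessThan_Suc intro!: sum.cong)
  qed
  have frac: "frac_term_ext m n \<alpha> = (\<Sum>j = 0..int M. of_int (2 * j) * h j)"
  proof -
    have "(\<Sum>j = 0..int M. of_int (2 * j) * h j) = (\<Sum>k<Suc M. of_int (2 * (int k + 0)) * h (int k + 0))"
      by (subst sum_nat_to_int_shift) simp
    then show ?thesis
      using frac_term_ext_eq_sum[OF assms, of m "Suc M" n]
      by (simp add: M_def h_def x_def y_def sum_distrib_left mult.assoc del: sum.lessThan_Suc)
  qed
  have "(\<Sum>j = int r + 2..int (M + r + 2). of_int (j - int r - 1) * h j)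
      + (\<Sum>j = - int r..int M - int r. of_int (j + int r + 1) * h j)
      = (\<Sum>j = 0..int M. of_int (2 * j) * h j)
      + (\<Sum>k = - int r..int r. of_int (int r - \<bar>k\<bar> + 1) * h k)"
    (is "?low + ?high = ?frac + ?mid")
  proof -
    let ?w = "\<lambda>J w j. if j \<in> J then w j else (0::int)"
    let ?l = "?w {int r + 2..int (M + r + 2)} (\<lambda>j. j - int r - 1)"
    let ?u = "?w {- int r..int M - int r} (\<lambda>j. j + int r + 1)"
    let ?f = "?w {0..int M} (\<lambda>j. 2 * j)"
    let ?c = "?w {- int r..int r} (\<lambda>k. int r - \<bar>k\<bar> + 1)"
    have "?low + ?high = (\<Sum>j\<in>I. of_int (?l j + ?u j) * h j)"
      by (subst (1 2) weights) (auto simp: I_def M_def distrib_right sum.distrib)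
    also have "\<dots> = (\<Sum>j\<in>I. of_int (?f j + ?c j) * h j)"
    proof (rule sum.cong[OF refl])
      fix j assume "j \<in> I"
      \<comment> \<open>For |j| <= r only \<open>?u\<close> contributes on the left, for j = r + 1
        it equals 2j, and beyond that the two weights add up to 2j. The ranges are cut off at
        different points above m, where \<open>h j\<close> is 0.\<close>
      then have "?l j + ?u j = ?f j + ?c j" if "j \<le> int m"
        using that by (auto simp: I_def M_def)
      then show "of_int (?l j + ?u j) * h j = of_int (?f j + ?c j) * h j"
        using h0[of j] by (cases "j \<le> int m") (simp_all only: not_le mult_zero_right)
    qed
    also have "\<dots> = ?frac + ?mid"
      by (subst (1 2) weights) (auto simp: I_def M_def distrib_right sum.distrib)
    finally show ?thesis .
  qed
  then show ?thesis
    using low high frac by (simp add: x_def y_def h_def mult.assoc)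
qed

end
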